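(* Let $n\ge1$. The map $\Psi:\mathcal{S}_n\to\mathcal{S}_n$ described in the context is well defined (the choices required in its construction can always be made), and for every $\pi\in\mathcal{S}_n$, with $\tau=\Psi(\pi)$: - (i) $\mathrm{WB}(\tau)=\mathrm{DB}'(\pi)$, - (ii) $\mathrm{WT}(\tau)=\mathrm{DT}'(\pi)$, - (iii) $C_{EE}(\tau)+C_{NN}(\tau)=\mathrm{rembr}(\pi)$. Moreover, $\Psi$ is a bijection.
   Context: Permutations $\pi=a_1\cdots a_n\in\mathcal{S}_n$ are in one-line notation. A descent is an index $i$ with $a_i>a_{i+1}$; then $a_i$ is a descent top and $a_{i+1}$ a descent bottom. For a letter $\ell$ of $\pi$, the right embracing number $\mathrm{rembr}(\ell)$ is the number of descents $\cdots yx\cdots$ (consecutive letters $y>x$) to the right of $\ell$ in $\pi$ with $x<\ell<y$; $\mathrm{rembr}(\pi)=\sum_{\ell}\mathrm{rembr}(\ell)$. $\mathrm{DB}'(\pi)$ is the set obtained from the set of descent bottoms of $\pi$ by adding $1$ to each element and adjoining the letter $1$. $\mathrm{DT}'(\pi)$ is the set obtained from the set of descent tops of $\pi$ by subtracting $1$ from each element and adjoining the letter $n$. For a permutation $\tau$, $\mathrm{WB}(\tau)=\{i:\tau(i)\ge i\}$ (weak excedance bottoms) and $\mathrm{WT}(\tau)=\{\tau(i):\tau(i)\ge i\}$ (weak excedance tops). For $\tau=t_1\cdots t_n$: $C_{EE}(i)=\{j: j<i\le t_j<t_i\}$, $C_{NN}(i)=\{j: t_i<t_j<i<j\}$, $C_{EE}(\tau)=\sum_i|C_{EE}(i)|$,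 $C_{NN}(\tau)=\sum_i|C_{NN}(i)|$. **The map $\Psi$.** Given $\pi\in\mathcal{S}_n$, let $F=\mathrm{DB}'(\pi)$ and $F'=\mathrm{DT}'(\pi)$. Let $G$ be obtained from the set of letters of $\pi$ that are not descent bottoms by removing $n$ and adding $1$ to each remaining letter, and let $G'$ be obtained from the set of letters that are not descent tops by removing $1$ and subtracting $1$ from each remaining letter. Define $\tau=\Psi(\pi)$ as follows. Process the elements $b$ of $F$ in decreasing order, letting $\tau(b)$ be the not-yet-used element $t\ge b$ of $F'$ such that exactly $\mathrm{rembr}(b)$ (computed in $\pi$) of the not-yet-used elements $x\in F'$ satisfy $b\le x<t$. Then process the elements $b$ of $G$ in increasing order, letting $\tau(b)$ be the not-yet-used element $d<b$ of $G'$ such that exactly $\mathrm{rembr}(b)$ of the not-yet-used elements $x\in G'$ satisfy $d<x<b$. *)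

theory Defs
  imports "HOL-Combinatorics.Permutations"
begin

text \<open>
  An element of the symmetric group of degree \<open>n\<close> is a function \<open>p :: nat \<Rightarrow> nat\<close> with
  \<open>p permutes {1..n}\<close>; its one-line notation is \<open>p 1, \<dots>, p n\<close>, so that the letter \<open>l\<close> stands at
  position \<open>inv p l\<close>.
\<close>

definition descents :: "nat \<Rightarrow> (nat \<Rightarrow> nat) \<Rightarrow> nat set" where
  "descents n p = {i \<in> {1..<n}. p i > p (i + 1)}"

definition descent_tops :: "nat \<Rightarrow> (nat \<Rightarrow> nat) \<Rightarrow> nat set" where
  "descent_tops n p = p ` descents n p"

definition descent_bottoms :: "nat \<Rightarrow> (nat \<Rightarrow> nat) \<Rightarrow> nat set" where
  "descent_bottoms n p = (\<lambda>i. p (i + 1)) ` descents n p"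

text \<open>
  In \<open>rembr\<close>, a descent that embraces \<open>l\<close> does not involve the letter \<open>l\<close> itself, so it lies to
  the right of \<open>l\<close> iff its first position exceeds the position of \<open>l\<close>.
\<close>

definition rembr :: "nat \<Rightarrow> (nat \<Rightarrow> nat) \<Rightarrow> nat \<Rightarrow> nat" where
  "rembr n p l = card {i \<in> descents n p. inv p l < i \<and> p (i + 1) < l \<and> l < p i}"

definition rembr_total :: "nat \<Rightarrow> (nat \<Rightarrow> nat) \<Rightarrow> nat" where
  "rembr_total n p = (\<Sum>l\<in>{1..n}. rembr n p l)"

definition DB' :: "nat \<Rightarrow> (nat \<Rightarrow> nat) \<Rightarrow> nat set" where
  "DB' n p = insert 1 ((\<lambda>x. x + 1) ` descent_bottoms n p)"

definition DT' :: "nat \<Rightarrow> (nat \<Rightarrow> nat) \<Rightarrow> nat set" where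
  "DT' n p = insert n ((\<lambda>x. x - 1) ` descent_tops n p)"

definition WB :: "nat \<Rightarrow> (nat \<Rightarrow> nat) \<Rightarrow> nat set" where
  "WB n t = {i \<in> {1..n}. t i \<ge> i}"

definition WT :: "nat \<Rightarrow> (nat \<Rightarrow> nat) \<Rightarrow> nat set" where
  "WT n t = t ` {i \<in> {1..n}. t i \<ge> i}"

definition C_EE_set :: "nat \<Rightarrow> (nat \<Rightarrow> nat) \<Rightarrow> nat \<Rightarrow> nat set" where
  "C_EE_set n t i = {j \<in> {1..n}. j < i \<and> i \<le> t j \<and> t j < t i}"

definition C_NN_set :: "nat \<Rightarrow> (nat \<Rightarrow> nat) \<Rightarrow> nat \<Rightarrow> nat set" where
  "C_NN_set n t i = {j \<in> {1..n}. t i < t j \<and> t j < i \<and> i < j}"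

definition C_EE :: "nat \<Rightarrow> (nat \<Rightarrow> nat) \<Rightarrow> nat" where
  "C_EE n t = (\<Sum>i\<in>{1..n}. card (C_EE_set n t i))"

definition C_NN :: "nat \<Rightarrow> (nat \<Rightarrow> nat) \<Rightarrow> nat" where
  "C_NN n t = (\<Sum>i\<in>{1..n}. card (C_NN_set n t i))"

definition G_set :: "nat \<Rightarrow> (nat \<Rightarrow> nat) \<Rightarrow> nat set" where
  "G_set n p = (\<lambda>x. x + 1) ` (({1..n} - descent_bottoms n p) - {n})"

definition G'_set :: "nat \<Rightarrow> (nat \<Rightarrow> nat) \<Rightarrow> nat set" where
  "G'_set n p = (\<lambda>x. x - 1) ` (({1..n} - descent_tops n p) - {1})"

text \<open>
  \<open>U\<close> is the set of not-yet-used values, \<open>b\<close> the letter being processed and \<open>v\<close> the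
  candidate for its image.
\<close>

definition choice_F :: "nat \<Rightarrow> (nat \<Rightarrow> nat) \<Rightarrow> nat set \<Rightarrow> nat \<Rightarrow> nat \<Rightarrow> bool" where
  "choice_F n p U b v \<longleftrightarrow>
     v \<in> U \<and> b \<le> v \<and> card {x \<in> U. b \<le> x \<and> x < v} = rembr n p b"

definition choice_G :: "nat \<Rightarrow> (nat \<Rightarrow> nat) \<Rightarrow> nat set \<Rightarrow> nat \<Rightarrow> nat \<Rightarrow> bool" where
  "choice_G n p U b v \<longleftrightarrow>
     v \<in> U \<and> v < b \<and> card {x \<in> U. v < x \<and> x < b} = rembr n p b"

text \<open>
  \<open>assign C bs U t\<close> processes the letters \<open>bs\<close> in the given order, starting from the unused values
  \<open>U\<close> and the partial assignment \<open>t\<close>. Its result is meaningful only if every choice along the way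
  is possible and unambiguous, which is what \<open>choices_ok C bs U\<close> asserts.
\<close>

fun assign ::
  "(nat set \<Rightarrow> nat \<Rightarrow> nat \<Rightarrow> bool) \<Rightarrow> nat list \<Rightarrow> nat set \<Rightarrow> (nat \<Rightarrow> nat) \<Rightarrow> (nat \<Rightarrow> nat)" where
  "assign C [] U t = t"
| "assign C (b # bs) U t =
     (let v = (THE v. C U b v) in assign C bs (U - {v}) (t(b := v)))"

fun choices_ok :: "(nat set \<Rightarrow> nat \<Rightarrow> nat \<Rightarrow> bool) \<Rightarrow> nat list \<Rightarrow> nat set \<Rightarrow> bool" where
  "choices_ok C [] U \<longleftrightarrow> True"
| "choices_ok C (b # bs) U \<longleftrightarrow>
     (\<exists>!v. C U b v) \<and> choices_ok C bs (U - {THE v. C U b v})"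

definition F_order :: "nat \<Rightarrow> (nat \<Rightarrow> nat) \<Rightarrow> nat list" where
  "F_order n p = rev (sorted_list_of_set (DB' n p))"

definition G_order :: "nat \<Rightarrow> (nat \<Rightarrow> nat) \<Rightarrow> nat list" where
  "G_order n p = sorted_list_of_set (G_set n p)"

text \<open>The initial assignment \<open>id\<close> only matters outside \<open>{1..n}\<close>.\<close>

definition Psi :: "nat \<Rightarrow> (nat \<Rightarrow> nat) \<Rightarrow> (nat \<Rightarrow> nat)" where
  "Psi n p =
     assign (choice_G n p) (G_order n p) (G'_set n p)
       (assign (choice_F n p) (F_order n p) (DT' n p) id)"

text \<open>Each letter of \<open>{1..n}\<close> is processed exactly once, and every choice is possible.\<close>

definition Psi_well_defined :: "nat \<Rightarrow> (nat \<Rightarrow> nat) \<Rightarrow> bool" where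
  "Psi_well_defined n p \<longleftrightarrow>
     DB' n p \<inter> G_set n p = {} \<and> DB' n p \<union> G_set n p = {1..n} \<and>
     choices_ok (choice_F n p) (F_order n p) (DT' n p) \<and>
     choices_ok (choice_G n p) (G_order n p) (G'_set n p)"

end

theory Submission
  imports Defs
begin

text \<open>
  When a letter \<open>b\<close> is processed, the number of candidates for its image is one more than the
  number of all descents \<open>y x\<close> with \<open>x < b < y\<close>, hence exceeds \<open>rembr b\<close>; so every choice is
  possible. The unused elements skipped at \<open>b\<close> are the images of the letters still to be processed,
  that is, of the elements of \<open>C_EE_set\<close> or \<open>C_NN_set\<close> at \<open>b\<close>.

  Hence the image of \<open>\<pi>\<close> determines the descent bottoms, the descent tops and all right embracing
  numbers of \<open>\<pi>\<close>. These determine \<open>\<pi>\<close>, which can be rebuilt by inserting the letters in increasing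
  order.
\<close>

subsection \<open>Greedy assignments by rank\<close>

text \<open>Both choice rules in one form: \<open>A b x\<close> says that \<open>x\<close> is
  admissible for \<open>b\<close>, and the admissible \<open>x\<close> with \<open>R x v\<close> are
  those skipped in favour of \<open>v\<close>.\<close>

definition rank_choice ::
  "(nat \<Rightarrow> nat \<Rightarrow> bool) \<Rightarrow> (nat \<Rightarrow> nat \<Rightarrow> bool) \<Rightarrow> (nat \<Rightarrow> nat) \<Rightarrow> nat set \<Rightarrow> nat \<Rightarrow> nat \<Rightarrow> bool" where
  "rank_choice A R r U b v \<longleftrightarrow> v \<in> U \<and> A b v \<and> card {x \<in> U. A b x \<and> R x v} = r b"

lemma choice_F_eq: "choice_F n p = rank_choice (\<le>) (<) (rembr n p)"
  by (auto simp: fun_eq_iff choice_F_def rank_choice_def)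

lemma choice_G_eq: "choice_G n p = rank_choice (>) (>) (rembr n p)"
proof -
  have "{x \<in> U. v < x \<and> x < b} = {x \<in> U. x < b \<and> v < x}" for U :: "nat set" and v b
    by auto
  then show ?thesis
    by (auto simp: fun_eq_iff choice_G_def rank_choice_def)
qed

text \<open>Ranks increase strictly along \<open>R\<close>, so they are distinct numbers below
  \<open>card S\<close>; by counting, each such number occurs.\<close>

lemma ex1_rank:
  assumes "finite S" "transp R" "irreflp R" "totalp R" "k < card S"
  shows "\<exists>!v. v \<in> S \<and> card {x \<in> S. R x v} = k"
proof -
  let ?f = "\<lambda>v. card {x \<in> S. R x v}"
  have less: "?f v < ?f w" if "v \<in> S" "R v w" for v w
  proof (rule psubset_card_mono)
    show "{x \<in> S. R x v} \<subset> {x \<in> S. R x w}"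
      using that assms(2,3) by (auto dest: transpD irreflpD)
  qed (use assms in auto)
  have inj: "inj_on ?f S"
  proof (rule inj_onI, rule ccontr)
    fix v w assume "v \<in> S" "w \<in> S" and eq: "?f v = ?f w" and "v \<noteq> w"
    then have "R v w \<or> R w v" using assms(4) by (auto dest: totalpD)
    then show False using less[of v w] less[of w v] \<open>v \<in> S\<close> \<open>w \<in> S\<close> eq by auto
  qed
  have "?f ` S \<subseteq> {..<card S}"
  proof clarify
    fix v assume v: "v \<in> S"
    have "{x \<in> S. R x v} \<subset> S" using v assms(3) by (auto dest: irreflpD)
    then show "?f v < card S" using assms(1) by (rule psubset_card_mono[rotated])
  qed
  then have "?f ` S = {..<card S}"
    by (intro card_subset_eq) (auto simp: card_image[OF inj])
  then have "k \<in> ?f ` S" using assms(5) by auto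
  then obtain v where "v \<in> S" "?f v = k" by auto
  then show ?thesis using inj by (auto dest: inj_onD)
qed

lemma ex1_rank_choice:
  assumes "finite U" "transp R" "irreflp R" "totalp R" "r b < card {x \<in> U. A b x}"
  shows "\<exists>!v. rank_choice A R r U b v"
proof -
  have "\<exists>!v. v \<in> {x \<in> U. A b x} \<and> card {x \<in> {x \<in> U. A b x}. R x v} = r b"
    by (rule ex1_rank) (use assms in auto)
  moreover have "{x \<in> {x \<in> U. A b x}. R x v} = {x \<in> U. A b x \<and> R x v}" for v
    by auto
  ultimately show ?thesis by (simp add: rank_choice_def conj_assoc)
qed

text \<open>Admissibility only grows along \<open>bs\<close>, so a value used earlier was also a
  candidate for every later letter. Exactly \<open>i\<close> of the initial candidates are gone when
  \<open>bs ! i\<close> is reached, which lets the hypothesis refer to the initial \<open>U\<close>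
  alone.\<close>

lemma choices_ok_rank_choice:
  assumes "finite U" "transp R" "irreflp R" "totalp R"
    and "sorted_wrt (\<lambda>b b'. \<forall>x. A b x \<longrightarrow> A b' x) bs"
    and "\<And>i. i < length bs \<Longrightarrow> r (bs ! i) + i < card {x \<in> U. A (bs ! i) x}"
  shows "choices_ok (rank_choice A R r) bs U"
  using assms(1,5,6)
proof (induction bs arbitrary: U)
  case (Cons b bs)
  have ex1: "\<exists>!v. rank_choice A R r U b v"
    by (rule ex1_rank_choice) (use Cons.prems(1) Cons.prems(3)[of 0] assms(2-4) in auto)
  define v where "v = (THE v. rank_choice A R r U b v)"
  have v: "rank_choice A R r U b v" unfolding v_def by (rule theI'[OF ex1])
  have "choices_ok (rank_choice A R r) bs (U - {v})"
  proof (rule Cons.IH)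
    fix i assume i: "i < length bs"
    have "A (bs ! i) v" using v Cons.prems(2) i by (auto simp: rank_choice_def)
    then have "{x \<in> U. A (bs ! i) x} = insert v {x \<in> U - {v}. A (bs ! i) x}"
      using v by (auto simp: rank_choice_def)
    then have "card {x \<in> U. A (bs ! i) x} = Suc (card {x \<in> U - {v}. A (bs ! i) x})"
      using Cons.prems(1) by simp
    then show "r (bs ! i) + i < card {x \<in> U - {v}. A (bs ! i) x}"
      using Cons.prems(3)[of "Suc i"] i by simp
  qed (use Cons.prems in auto)
  then show ?case using ex1 by (simp add: v_def)
qed simp

lemma assign_outside: "b \<notin> set bs \<Longrightarrow> assign C bs U t b = t b"
  by (induction bs arbitrary: U t) (auto simp: Let_def)

text \<open>Later updates never touch a letter already processed, so the final function still shows
  each choice and the values used before it.\<close>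

lemma assign_choice:
  assumes "choices_ok C bs U" "distinct bs" "bs = xs @ b # ys"
  shows "C (U - assign C bs U t ` set xs) b (assign C bs U t b)"
  using assms
proof (induction bs arbitrary: U t xs)
  case (Cons c cs)
  define v where "v = (THE v. C U c v)"
  have "\<exists>!v. C U c v" using Cons.prems(1) by simp
  then have v: "C U c v" unfolding v_def by (rule theI')
  have c: "assign C (c # cs) U t c = v"
    using Cons.prems(2) by (simp add: v_def Let_def assign_outside)
  show ?case
  proof (cases xs)
    case Nil
    then show ?thesis using Cons.prems c v by simp
  next
    case (Cons d ds)
    then have "cs = ds @ b # ys" "d = c" using Cons.prems by auto
    moreover have t: "assign C (c # cs) U t = assign C cs (U - {v}) (t(c := v))"
      by (simp add: v_def Let_def)
    moreover have "U - assign C (c # cs) U t ` set xs =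
        U - {v} - assign C cs (U - {v}) (t(c := v)) ` set ds"
      using c Cons \<open>d = c\<close> by (auto simp: t simp del: assign.simps)
    moreover have "choices_ok C cs (U - {v})" "distinct cs"
      using Cons.prems(1,2) by (simp_all add: v_def)
    ultimately show ?thesis
      using Cons.IH[of "U - {v}" ds "t(c := v)"] by (simp only:)
  qed
qed simp

lemma assign_bij_betw:
  assumes "choices_ok C bs U" "distinct bs" "finite U" "card U = length bs"
    and "\<And>U b v. C U b v \<Longrightarrow> v \<in> U"
  shows "bij_betw (assign C bs U t) (set bs) U"
  using assms(1-4)
proof (induction bs arbitrary: U t)
  case (Cons c cs)
  define v where "v = (THE v. C U c v)"
  have v: "v \<in> U" unfolding v_def
    by (rule assms(5), rule theI') (use Cons.prems in simp)
  let ?t = "assign C (c # cs) U t"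
  have "bij_betw (assign C cs (U - {v}) (t(c := v))) (set cs) (U - {v})"
    by (rule Cons.IH) (use Cons.prems v in \<open>auto simp: v_def\<close>)
  then have "bij_betw ?t (set cs) (U - {v})" by (simp add: v_def Let_def)
  moreover have "?t c = v"
    using Cons.prems by (simp add: v_def Let_def assign_outside)
  ultimately have "bij_betw ?t (set cs \<union> {c}) ((U - {v}) \<union> {v})"
    using notIn_Un_bij_betw[of c "set cs" ?t "U - {v}"] Cons.prems by simp
  then show ?case using v by (simp add: insert_absorb)
qed (simp add: bij_betw_def)

lemma assign_choice_remaining:
  assumes "choices_ok C bs U" "distinct bs" "finite U" "card U = length bs"
    and "\<And>U b v. C U b v \<Longrightarrow> v \<in> U" and "bs = xs @ b # ys"
  shows "C (assign C bs U t ` set (b # ys)) b (assign C bs U t b)"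
proof -
  let ?t = "assign C bs U t"
  have "bij_betw ?t (set bs) U" by (rule assign_bij_betw[OF assms(1-5)])
  then have inj: "inj_on ?t (set bs)" and U: "U = ?t ` set bs"
    by (auto simp: bij_betw_def)
  have "?t ` (set bs - set xs) = ?t ` set bs - ?t ` set xs"
    by (rule inj_on_image_set_diff[OF inj]) (auto simp: assms(6))
  then have "U - ?t ` set xs = ?t ` (set bs - set xs)" by (simp only: U[symmetric])
  also have "set bs - set xs = set (b # ys)" using assms(2,6) by auto
  finally show ?thesis using assign_choice[OF assms(1,2,6), of t] by simp
qed

subsection \<open>Counting descents across a letter\<close>

context
  fixes n :: nat and p :: "nat \<Rightarrow> nat"
  assumes n: "n \<ge> 1" and p: "p permutes {1..n}"
begin

lemma range_p: "i \<in> {1..n} \<Longrightarrow> p i \<in> {1..n}"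
  using permutes_in_image[OF p] by auto

lemma inj_p: "p i = p j \<longleftrightarrow> i = j"
  using permutes_inj[OF p] by (auto dest: injD)

lemma descentsD:
  assumes "i \<in> descents n p"
  shows "i \<in> {1..<n}" "p (Suc i) < p i" "1 \<le> p (Suc i)" "p i \<le> n"
  using assms range_p[of i] range_p[of "Suc i"] by (auto simp: descents_def)

lemma finite_descents [simp]: "finite (descents n p)"
  by (simp add: descents_def)

lemma DB'_eq: "DB' n p = insert 1 ((\<lambda>i. Suc (p (Suc i))) ` descents n p)"
  by (auto simp: DB'_def descent_bottoms_def)

lemma DT'_eq: "DT' n p = insert n ((\<lambda>i. p i - 1) ` descents n p)"
  by (auto simp: DT'_def descent_tops_def)

lemma inj_on_bottoms: "inj_on (\<lambda>i. Suc (p (Suc i))) A"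
  by (auto simp: inj_on_def inj_p)

text \<open>Truncated subtraction loses nothing here, since descent tops are positive.\<close>

lemma inj_on_tops: "inj_on (\<lambda>i. p i - 1) (descents n p)"
proof (rule inj_onI)
  fix i j assume "i \<in> descents n p" "j \<in> descents n p" "p i - 1 = p j - 1"
  then have "p i = p j" using descentsD[of i] descentsD[of j] by linarith
  then show "i = j" by (simp add: inj_p)
qed

lemma finite_DB' [simp]: "finite (DB' n p)" and finite_DT' [simp]: "finite (DT' n p)"
  by (simp_all add: DB'_eq DT'_eq)

lemma DB'_subset: "DB' n p \<subseteq> {1..n}"
  using n descentsD by (fastforce simp: DB'_eq)

lemma DT'_subset: "DT' n p \<subseteq> {1..n}"
  using n descentsD by (fastforce simp: DT'_eq)

lemma card_DB': "card (DB' n p) = Suc (card (descents n p))"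
proof -
  have "1 \<notin> (\<lambda>i. Suc (p (Suc i))) ` descents n p" using descentsD by fastforce
  then show ?thesis by (simp add: DB'_eq card_image[OF inj_on_bottoms])
qed

lemma card_DT': "card (DT' n p) = Suc (card (descents n p))"
proof -
  have "n \<notin> (\<lambda>i. p i - 1) ` descents n p" using descentsD n by fastforce
  then show ?thesis using card_image[OF inj_on_tops] by (simp add: DT'_eq)
qed

text \<open>Descent bottoms are positive, so the adjoined 1 is never a shifted bottom and removing
  it undoes the construction of \<open>DB'\<close>.\<close>

lemma descent_bottoms_eq: "descent_bottoms n p = (\<lambda>x. x - 1) ` (DB' n p - {1})"
proof -
  have "1 \<notin> (\<lambda>i. Suc (p (Suc i))) ` descents n p" using descentsD by fastforce
  then have "DB' n p - {1} = (\<lambda>i. Suc (p (Suc i))) ` descents n p" by (auto simp: DB'_eq)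
  then show ?thesis by (auto simp: descent_bottoms_def image_image)
qed

lemma descent_tops_eq: "descent_tops n p = Suc ` (DT' n p - {n})"
proof -
  have "n \<notin> (\<lambda>i. p i - 1) ` descents n p" using descentsD n by fastforce
  then have "DT' n p - {n} = (\<lambda>i. p i - 1) ` descents n p" by (auto simp: DT'_eq)
  moreover have "(\<lambda>i. Suc (p i - 1)) ` descents n p = p ` descents n p"
    by (rule image_cong) (use descentsD in fastforce)+
  ultimately show ?thesis by (simp add: descent_tops_def image_image)
qed

text \<open>The shift carries the letters below \<open>n\<close> onto \<open>{2..n}\<close>, and 1
  always lies in \<open>DB'\<close>.\<close>

lemma G_set_eq: "G_set n p = {1..n} - DB' n p"
proof -
  have "x \<in> G_set n p" if "x \<in> {1..n} - DB' n p" for x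
  proof -
    have "x - 1 \<in> {1..n} - descent_bottoms n p - {n}" "x = x - 1 + 1"
      using that by (auto simp: DB'_def image_iff)
    then show ?thesis unfolding G_set_def by (rule rev_image_eqI)
  qed
  moreover have "G_set n p \<subseteq> {1..n} - DB' n p" by (auto simp: G_set_def DB'_def)
  ultimately show ?thesis by blast
qed

lemma G'_set_eq: "G'_set n p = {1..n} - DT' n p"
proof -
  have "x \<in> G'_set n p" if "x \<in> {1..n} - DT' n p" for x
  proof -
    have "x + 1 \<in> {1..n} - descent_tops n p - {1}" "x = x + 1 - 1"
      using that by (auto simp: DT'_def image_iff)
    then show ?thesis unfolding G'_set_def by (rule rev_image_eqI)
  qed
  moreover have "x - 1 \<notin> DT' n p" if "x \<in> {1..n} - descent_tops n p - {1}" for x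
  proof
    assume "x - 1 \<in> DT' n p"
    moreover have "x - 1 \<noteq> n" using that by auto
    ultimately obtain i where "i \<in> descents n p" "x - 1 = p i - 1"
      unfolding DT'_eq by blast
    then have "x = p i" using that descentsD[of i] by auto
    then show False using that \<open>i \<in> descents n p\<close> by (auto simp: descent_tops_def)
  qed
  then have "G'_set n p \<subseteq> {1..n} - DT' n p" by (fastforce simp: G'_set_def)
  ultimately show ?thesis by blast
qed

text \<open>The descents with top above \<open>b\<close> split by whether their bottom is at least
  \<open>b\<close> or below it. The extra one is the adjoined \<open>n\<close>; the adjoined 1 of
  \<open>DB'\<close> is never above \<open>b\<close>.\<close>

lemma card_DT'_ge:
  assumes "b \<in> {1..n}"
  shows "card {x \<in> DT' n p. b \<le> x} =
    Suc (card {x \<in> DB' n p. b < x} + card {i \<in> descents n p. p (Suc i) < b \<and> b < p i})"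
proof -
  let ?D = "descents n p"
  have "{x \<in> DT' n p. b \<le> x} = insert n ((\<lambda>i. p i - 1) ` {i \<in> ?D. b < p i})"
    using assms by (auto simp: DT'_eq)
  moreover have "n \<notin> (\<lambda>i. p i - 1) ` {i \<in> ?D. b < p i}" using descentsD n by fastforce
  moreover have "inj_on (\<lambda>i. p i - 1) {i \<in> ?D. b < p i}"
    by (rule inj_on_subset[OF inj_on_tops]) auto
  ultimately have 1: "card {x \<in> DT' n p. b \<le> x} = Suc (card {i \<in> ?D. b < p i})"
    by (simp add: card_image)
  have "{x \<in> DB' n p. b < x} = (\<lambda>i. Suc (p (Suc i))) ` {i \<in> ?D. b \<le> p (Suc i)}"
    using assms by (auto simp: DB'_eq)
  then have 2: "card {x \<in> DB' n p. b < x} = card {i \<in> ?D. b \<le> p (Suc i)}"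
    by (simp add: card_image[OF inj_on_bottoms])
  have "{i \<in> ?D. b < p i} = {i \<in> ?D. b \<le> p (Suc i)} \<union> {i \<in> ?D. p (Suc i) < b \<and> b < p i}"
    using descentsD(2) by force
  moreover have "{i \<in> ?D. b \<le> p (Suc i)} \<inter> {i \<in> ?D. p (Suc i) < b \<and> b < p i} = {}"
    by auto
  ultimately show ?thesis using 1 2 by (simp add: card_Un_disjoint)
qed

lemma rembr_le: "rembr n p b \<le> card {i \<in> descents n p. p (Suc i) < b \<and> b < p i}"
  unfolding rembr_def by (rule card_mono) auto

text \<open>In decreasing order the elements of \<open>DB'\<close> above \<open>b\<close> precede
  \<open>b\<close>, so this is the supply of candidates that \<open>choices_ok_rank_choice\<close>
  asks for.\<close>

lemma rembr_less_F:
  assumes "b \<in> {1..n}"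
  shows "rembr n p b + card {x \<in> DB' n p. b < x} < card {x \<in> DT' n p. b \<le> x}"
  using card_DT'_ge[OF assms] rembr_le[of b] by simp

lemma card_split_less:
  fixes b :: nat
  assumes "finite A"
  shows "card A = card {x \<in> A. x < b} + card {x \<in> A. b \<le> x}"
proof -
  have "A = {x \<in> A. x < b} \<union> {x \<in> A. b \<le> x}" by auto
  also have "card \<dots> = card {x \<in> A. x < b} + card {x \<in> A. b \<le> x}"
    by (rule card_Un_disjoint) (use assms in auto)
  finally show ?thesis .
qed

lemma card_complement_less:
  assumes "A \<subseteq> {1..n}" "b \<in> {1..n}"
  shows "card {x \<in> {1..n} - A. x < b} + card {x \<in> A. x < b} = b - 1"
proof -
  have "finite A" using assms(1) by (rule finite_subset) simp
  then have "card {x \<in> {1..n} - A. x < b} + card {x \<in> A. x < b} =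
      card ({x \<in> {1..n} - A. x < b} \<union> {x \<in> A. x < b})"
    by (intro card_Un_disjoint[symmetric]) auto
  also have "{x \<in> {1..n} - A. x < b} \<union> {x \<in> A. x < b} = {1..<b}" using assms by auto
  finally show ?thesis by simp
qed

text \<open>Follows from \<open>rembr_less_F\<close> by passing to complements: \<open>DB'\<close>
  and \<open>DT'\<close> have equal size, so the surplus of \<open>G'_set\<close> over
  \<open>G_set\<close> below \<open>b\<close> equals the surplus of \<open>DT'\<close> over
  \<open>DB'\<close> from \<open>b\<close> on, and \<open>b\<close> itself is not in
  \<open>DB'\<close>.\<close>

lemma rembr_less_G:
  assumes "b \<in> G_set n p"
  shows "rembr n p b + card {x \<in> G_set n p. x < b} < card {x \<in> G'_set n p. x < b}"
proof -
  have b: "b \<in> {1..n}" "b \<notin> DB' n p" using assms by (auto simp: G_set_eq)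
  have "{x \<in> DB' n p. b \<le> x} = {x \<in> DB' n p. b < x}" using b(2) by (auto simp: le_less)
  then show ?thesis
    using card_complement_less[OF DB'_subset b(1)] card_complement_less[OF DT'_subset b(1)]
      rembr_less_F[OF b(1)] card_split_less[of "DB' n p" b] card_split_less[of "DT' n p" b]
    by (simp add: G_set_eq G'_set_eq card_DB' card_DT')
qed

subsection \<open>The image permutation\<close>

lemma finite_G_set [simp]: "finite (G_set n p)" and finite_G'_set [simp]: "finite (G'_set n p)"
  by (simp_all add: G_set_eq G'_set_eq)

lemma F_order_props:
  "set (F_order n p) = DB' n p" "distinct (F_order n p)" "sorted_wrt (>) (F_order n p)"
  using strict_sorted_list_of_set[of "DB' n p"]
  by (auto simp: F_order_def sorted_wrt_rev)

lemma G_order_props: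
  "set (G_order n p) = G_set n p" "distinct (G_order n p)" "sorted_wrt (<) (G_order n p)"
  by (auto simp: G_order_def)

text \<open>Turns the list index of \<open>choices_ok_rank_choice\<close> into the number of earlier
  letters, as it occurs in the two inequalities on \<open>rembr\<close>.\<close>

lemma index_eq_card:
  assumes "sorted_wrt R bs" "distinct bs" "i < length bs" "transp R" "irreflp R"
  shows "card {x \<in> set bs. R x (bs ! i)} = i"
proof -
  have *: "R (bs ! j) (bs ! i) \<longleftrightarrow> j < i" if "j < length bs" for j
    using sorted_wrt_nth_less[OF assms(1), of i j] sorted_wrt_nth_less[OF assms(1), of j i]
      assms(3-5) that by (metis irreflpD linorder_neqE_nat transpD)
  have "{x \<in> set bs. R x (bs ! i)} = (!) bs ` {..<i}"
  proof (intro set_eqI iffI)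
    fix x assume "x \<in> (!) bs ` {..<i}"
    then obtain j where "j < i" "x = bs ! j" by auto
    then show "x \<in> {x \<in> set bs. R x (bs ! i)}" using *[of j] assms(3) by simp
  qed (use * in \<open>auto simp: in_set_conv_nth\<close>)
  moreover have "inj_on ((!) bs) {..<i}"
    using assms(2,3) by (auto simp: inj_on_def nth_eq_iff_index_eq)
  ultimately show ?thesis by (simp add: card_image)
qed

lemma choices_ok_F: "choices_ok (choice_F n p) (F_order n p) (DT' n p)"
  unfolding choice_F_eq
proof (rule choices_ok_rank_choice)
  show "sorted_wrt (\<lambda>b b'. \<forall>x. b \<le> x \<longrightarrow> b' \<le> x) (F_order n p)"
    by (rule sorted_wrt_mono_rel[OF _ F_order_props(3)]) auto
  fix i assume i: "i < length (F_order n p)"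
  then have "F_order n p ! i \<in> DB' n p" using F_order_props(1) nth_mem by blast
  then have "F_order n p ! i \<in> {1..n}" using DB'_subset by blast
  moreover have "card {x \<in> DB' n p. F_order n p ! i < x} = i"
    using index_eq_card[OF F_order_props(3,2) i] F_order_props(1) by simp
  ultimately show "rembr n p (F_order n p ! i) + i < card {x \<in> DT' n p. F_order n p ! i \<le> x}"
    using rembr_less_F by fastforce
qed auto

lemma choices_ok_G: "choices_ok (choice_G n p) (G_order n p) (G'_set n p)"
  unfolding choice_G_eq
proof (rule choices_ok_rank_choice)
  show "sorted_wrt (\<lambda>b b'. \<forall>x. x < b \<longrightarrow> x < b') (G_order n p)"
    by (rule sorted_wrt_mono_rel[OF _ G_order_props(3)]) auto
  fix i assume i: "i < length (G_order n p)"
  then have "G_order n p ! i \<in> G_set n p" using G_order_props(1) nth_mem by blast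
  moreover have "card {x \<in> G_set n p. x < G_order n p ! i} = i"
    using index_eq_card[OF G_order_props(3,2) i] G_order_props(1) by simp
  ultimately show "rembr n p (G_order n p ! i) + i < card {x \<in> G'_set n p. x < G_order n p ! i}"
    using rembr_less_G by fastforce
qed auto

lemma well_defined: "Psi_well_defined n p"
  using choices_ok_F choices_ok_G DB'_subset by (auto simp: Psi_well_defined_def G_set_eq)

lemma length_F_order: "card (DT' n p) = length (F_order n p)"
  by (simp add: F_order_def card_DB' card_DT')

lemma length_G_order: "card (G'_set n p) = length (G_order n p)"
  using card_Diff_subset[OF _ DB'_subset] card_Diff_subset[OF _ DT'_subset]
  by (simp add: G_order_def G_set_eq G'_set_eq card_DB' card_DT')

lemma choice_F_mem: "choice_F n p U b v \<Longrightarrow> v \<in> U"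
  by (simp add: choice_F_def)

lemma choice_G_mem: "choice_G n p U b v \<Longrightarrow> v \<in> U"
  by (simp add: choice_G_def)

text \<open>The second pass writes only on \<open>G_set\<close>, which is disjoint from
  \<open>DB'\<close>, so the values of the first pass survive.\<close>

lemma Psi_F: "b \<in> DB' n p \<Longrightarrow> Psi n p b = assign (choice_F n p) (F_order n p) (DT' n p) id b"
  unfolding Psi_def by (rule assign_outside) (auto simp: G_order_props G_set_eq)

lemma bij_betw_Psi_F: "bij_betw (Psi n p) (DB' n p) (DT' n p)"
proof -
  have "bij_betw (assign (choice_F n p) (F_order n p) (DT' n p) id) (DB' n p) (DT' n p)"
    using assign_bij_betw[OF choices_ok_F F_order_props(2) finite_DT' length_F_order choice_F_mem]
    by (simp add: F_order_props)
  then show ?thesis using Psi_F by (simp cong: bij_betw_cong)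
qed

lemma bij_betw_Psi_G: "bij_betw (Psi n p) (G_set n p) (G'_set n p)"
  using assign_bij_betw[OF choices_ok_G G_order_props(2) finite_G'_set length_G_order choice_G_mem]
  by (simp add: G_order_props Psi_def)

lemma Psi_choice_F:
  assumes "b \<in> DB' n p"
  shows "choice_F n p (Psi n p ` {j \<in> DB' n p. j \<le> b}) b (Psi n p b)"
proof -
  obtain xs ys where split: "F_order n p = xs @ b # ys"
    using assms F_order_props(1) by (metis split_list)
  have "choice_F n p (assign (choice_F n p) (F_order n p) (DT' n p) id ` set (b # ys)) b
      (assign (choice_F n p) (F_order n p) (DT' n p) id b)"
    by (rule assign_choice_remaining[OF choices_ok_F F_order_props(2) finite_DT' length_F_order
          choice_F_mem split])
  moreover have "set (b # ys) = {j \<in> DB' n p. j \<le> b}"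
    unfolding F_order_props(1)[symmetric]
    using F_order_props(3) split by (auto simp: sorted_wrt_append)
  moreover have "assign (choice_F n p) (F_order n p) (DT' n p) id ` {j \<in> DB' n p. j \<le> b} =
      Psi n p ` {j \<in> DB' n p. j \<le> b}"
    by (rule image_cong) (auto simp: Psi_F)
  ultimately show ?thesis by (simp only: Psi_F[OF assms])
qed

lemma Psi_choice_G:
  assumes "b \<in> G_set n p"
  shows "choice_G n p (Psi n p ` {j \<in> G_set n p. b \<le> j}) b (Psi n p b)"
proof -
  obtain xs ys where split: "G_order n p = xs @ b # ys"
    using assms G_order_props(1) by (metis split_list)
  have "choice_G n p (Psi n p ` set (b # ys)) b (Psi n p b)"
    unfolding Psi_def
    by (rule assign_choice_remaining[OF choices_ok_G G_order_props(2) finite_G'_set length_G_order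
          choice_G_mem split])
  moreover have "set (b # ys) = {j \<in> G_set n p. b \<le> j}"
    unfolding G_order_props(1)[symmetric]
    using G_order_props(3) split by (auto simp: sorted_wrt_append)
  ultimately show ?thesis by (simp only:)
qed

lemma Psi_ge: "b \<in> DB' n p \<Longrightarrow> b \<le> Psi n p b"
  using Psi_choice_F by (auto simp: choice_F_def)

lemma Psi_less: "b \<in> G_set n p \<Longrightarrow> Psi n p b < b"
  using Psi_choice_G by (auto simp: choice_G_def)

lemma Psi_permutes: "Psi n p permutes {1..n}"
proof (rule bij_imp_permutes)
  have "bij_betw (Psi n p) (DB' n p \<union> G_set n p) (DT' n p \<union> G'_set n p)"
    by (rule bij_betw_combine[OF bij_betw_Psi_F bij_betw_Psi_G]) (auto simp: G'_set_eq)
  moreover have "DB' n p \<union> G_set n p = {1..n}" "DT' n p \<union> G'_set n p = {1..n}"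
    using DB'_subset DT'_subset by (auto simp: G_set_eq G'_set_eq)
  ultimately show "bij_betw (Psi n p) {1..n} {1..n}" by simp
next
  fix x assume "x \<notin> {1..n}"
  then have "x \<notin> set (F_order n p)" "x \<notin> set (G_order n p)"
    using DB'_subset by (auto simp: F_order_props G_order_props G_set_eq)
  then show "Psi n p x = x" by (simp add: Psi_def assign_outside)
qed

lemma WB_Psi: "WB n (Psi n p) = DB' n p"
  using Psi_ge Psi_less DB'_subset by (force simp: WB_def G_set_eq)

lemma WT_Psi: "WT n (Psi n p) = DT' n p"
  using WB_Psi bij_betw_Psi_F by (auto simp: WT_def WB_def bij_betw_def)

section \<open>Crossings of the image and right embracing numbers\<close>

lemma card_C_EE_set:
  assumes "b \<in> DB' n p"
  shows "card (C_EE_set n (Psi n p) b) = rembr n p b"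
proof -
  have inj: "inj (Psi n p)" by (rule permutes_inj[OF Psi_permutes])
  have "j \<in> DB' n p" if "j \<in> {1..n}" "j < b" "b \<le> Psi n p j" for j
    using that Psi_less[of j] by (auto simp: G_set_eq)
  \<comment> \<open>Here \<open>j \<le> b\<close> may replace \<open>j < b\<close>, since the strict
    inequality between the images excludes \<open>j = b\<close>.\<close>
  then have "C_EE_set n (Psi n p) b =
      {j \<in> DB' n p. j \<le> b \<and> b \<le> Psi n p j \<and> Psi n p j < Psi n p b}"
    using DB'_subset by (auto simp: C_EE_set_def order_less_le)
  then have "Psi n p ` C_EE_set n (Psi n p) b =
      {x \<in> Psi n p ` {j \<in> DB' n p. j \<le> b}. b \<le> x \<and> x < Psi n p b}"
    by auto
  also have "card \<dots> = rembr n p b" using Psi_choice_F[OF assms] by (simp add: choice_F_def)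
  finally show ?thesis by (simp add: card_image inj_on_subset[OF inj])
qed

lemma card_C_NN_set:
  assumes "b \<in> G_set n p"
  shows "card (C_NN_set n (Psi n p) b) = rembr n p b"
proof -
  have inj: "inj (Psi n p)" by (rule permutes_inj[OF Psi_permutes])
  have "j \<in> G_set n p" if "j \<in> {1..n}" "b < j" "Psi n p j < b" for j
    using that Psi_ge[of j] by (auto simp: G_set_eq)
  then have "C_NN_set n (Psi n p) b =
      {j \<in> G_set n p. b \<le> j \<and> Psi n p b < Psi n p j \<and> Psi n p j < b}"
    by (auto simp: C_NN_set_def order_less_le G_set_eq)
  then have "Psi n p ` C_NN_set n (Psi n p) b =
      {x \<in> Psi n p ` {j \<in> G_set n p. b \<le> j}. Psi n p b < x \<and> x < b}"
    by auto
  also have "card \<dots> = rembr n p b" using Psi_choice_G[OF assms] by (simp add: choice_G_def)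
  finally show ?thesis by (simp add: card_image inj_on_subset[OF inj])
qed

text \<open>One summand always vanishes: the second at a weak excedance, the first elsewhere. The
  image alone therefore determines every right embracing number.\<close>

lemma rembr_eq_card_C:
  assumes "b \<in> {1..n}"
  shows "rembr n p b = card (C_EE_set n (Psi n p) b) + card (C_NN_set n (Psi n p) b)"
proof (cases "b \<in> DB' n p")
  case True
  then have "C_NN_set n (Psi n p) b = {}" using Psi_ge[of b] by (auto simp: C_NN_set_def)
  then show ?thesis using card_C_EE_set[OF True] by simp
next
  case False
  then have b: "b \<in> G_set n p" using assms by (simp add: G_set_eq)
  then have "C_EE_set n (Psi n p) b = {}" using Psi_less[of b] by (auto simp: C_EE_set_def)
  then show ?thesis using card_C_NN_set[OF b] by simp
qed

lemma C_total: "C_EE n (Psi n p) + C_NN n (Psi n p) = rembr_total n p"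
proof -
  have "rembr_total n p =
      (\<Sum>b\<in>{1..n}. card (C_EE_set n (Psi n p) b) + card (C_NN_set n (Psi n p) b))"
    unfolding rembr_total_def by (rule sum.cong[OF refl rembr_eq_card_C])
  then show ?thesis by (simp only: C_EE_def C_NN_def sum.distrib)
qed

subsection \<open>Recovering the permutation\<close>

text \<open>The fixed points outside \<open>{1..n}\<close> serve as sentinels: the letter 0 before
  the word and \<open>n + 1\<close> after it.\<close>

lemma p_0: "p 0 = 0" and p_Suc_n: "p (Suc n) = Suc n"
  using permutes_not_in[OF p] by auto

lemma apply_inv: "p (inv p a) = a" and inv_apply: "inv p (p i) = i"
  using permutes_inverses[OF p] by auto

lemma inv_p_0: "inv p 0 = 0"
  using inv_apply[of 0] by (simp add: p_0)

lemma inv_p_le: "a \<le> n \<Longrightarrow> inv p a \<le> n"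
  using permutes_in_image[OF permutes_inv[OF p], of a] inv_p_0 by (cases "a = 0") auto

lemma inv_p_ge: "a \<in> {1..n} \<Longrightarrow> inv p a \<in> {1..n}"
  using permutes_in_image[OF permutes_inv[OF p], of a] by auto

lemma inv_eq_iff: "inv p a = inv p b \<longleftrightarrow> a = b"
  by (metis apply_inv)

text \<open>The right neighbour of the last letter is the sentinel \<open>n + 1\<close>, so the last
  position needs no exception.\<close>

lemma descent_top_iff:
  assumes "l \<in> {1..n}"
  shows "l \<in> descent_tops n p \<longleftrightarrow> p (Suc (inv p l)) < l"
proof -
  have "l \<in> descent_tops n p \<longleftrightarrow> inv p l \<in> descents n p"
    unfolding descent_tops_def by (metis image_iff inv_apply apply_inv)
  also have "\<dots> \<longleftrightarrow> p (Suc (inv p l)) < l"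
    using inv_p_ge[OF assms] assms p_Suc_n by (cases "inv p l = n") (auto simp: descents_def apply_inv)
  finally show ?thesis .
qed

text \<open>The left neighbour of the first letter is the sentinel 0, so the first position needs no
  exception.\<close>

lemma descent_bottom_iff:
  assumes "l \<in> {1..n}"
  shows "l \<in> descent_bottoms n p \<longleftrightarrow> l < p (inv p l - 1)"
proof
  assume "l \<in> descent_bottoms n p"
  then obtain i where "i \<in> descents n p" "l = p (Suc i)"
    by (auto simp: descent_bottoms_def)
  then show "l < p (inv p l - 1)" using descentsD[of i] by (simp add: inv_apply)
next
  assume *: "l < p (inv p l - 1)"
  obtain i where i: "inv p l = Suc i" using inv_p_ge[OF assms] by (cases "inv p l") auto
  have "i \<noteq> 0" using * i p_0 by (cases i) auto
  moreover have "p (Suc i) = l" by (simp add: apply_inv flip: i)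
  ultimately have "i \<in> descents n p"
    using * i inv_p_ge[OF assms] by (auto simp: descents_def)
  then show "l \<in> descent_bottoms n p"
    using \<open>p (Suc i) = l\<close> by (auto simp: descent_bottoms_def)
qed

end

section \<open>Level crossings and blocks of small letters\<close>

text \<open>Passages out of \<open>P\<close> and into \<open>P\<close> alternate, so their numbers
  differ only through the values of \<open>P\<close> at the two ends.\<close>

lemma card_crossings:
  fixes P :: "nat \<Rightarrow> bool"
  assumes "a \<le> b"
  shows "card {i \<in> {a..<b}. P i \<and> \<not> P (Suc i)} + of_bool (P b) =
    card {i \<in> {a..<b}. \<not> P i \<and> P (Suc i)} + of_bool (P a)"
  using assms
proof (induction b rule: dec_induct)
  case (step m)
  have "{i \<in> {a..<Suc m}. Q i} = {i \<in> {a..<m}. Q i} \<union> (if Q m then {m} else {})" for Q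
    using step.hyps by (auto simp: less_Suc_eq)
  then have "card {i \<in> {a..<Suc m}. Q i} = card {i \<in> {a..<m}. Q i} + of_bool (Q m)" for Q
    by simp
  then show ?case using step.IH by auto
qed simp

lemma ex_crossing:
  fixes P :: "nat \<Rightarrow> bool"
  assumes "a \<le> b" "\<not> P a" "P b"
  shows "\<exists>i. a \<le> i \<and> i < b \<and> \<not> P i \<and> P (Suc i)"
proof (rule ccontr)
  assume "\<not> ?thesis"
  then have none: "{i \<in> {a..<b}. \<not> P i \<and> P (Suc i)} = {}" by auto
  show False using card_crossings[OF assms(1), of P] assms(2,3) unfolding none by simp
qed

text \<open>
  The letters up to \<open>k\<close>, together with the letter 0 at position 0, form maximal blocks of
  consecutive positions. The following set consists of the last letters of these blocks.
\<close>

definition block_ends :: "(nat \<Rightarrow> nat) \<Rightarrow> nat \<Rightarrow> nat set" where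
  "block_ends p k = {a. a \<le> k \<and> k < p (Suc (inv p a))}"

lemma finite_block_ends [simp]: "finite (block_ends p k)"
  by (simp add: block_ends_def)

context
  fixes n :: nat and p :: "nat \<Rightarrow> nat" and k :: nat
  assumes n: "n \<ge> 1" and p: "p permutes {1..n}" and k: "k < n"
begin

lemmas p_inv = apply_inv[OF n p] and inv_p = inv_apply[OF n p] and inv_p_eq_iff = inv_eq_iff[OF n p]

text \<open>
  To the right of the letter \<open>Suc k\<close>, the word crosses the level between \<open>k\<close> and \<open>Suc k\<close> upwards
  as often as downwards, because it starts and ends (with \<open>n + 1\<close> at position \<open>n + 1\<close>) above it.
\<close>

lemma card_block_ends_right:
  "card {x \<in> block_ends p k. inv p (Suc k) < inv p x} =
    rembr n p (Suc k) + of_bool (Suc k \<in> descent_tops n p)"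
proof -
  define a where "a = inv p (Suc k)"
  have a: "a \<in> {1..n}" "p a = Suc k"
    using inv_p_ge[OF n p, of "Suc k"] k p_inv by (auto simp: a_def)
  have top: "Suc k \<in> descent_tops n p \<longleftrightarrow> p (Suc a) \<le> k"
    using descent_top_iff[OF n p, of "Suc k"] k by (auto simp: a_def)
  \<comment> \<open>An upward passage at position \<open>i\<close> means that \<open>p i\<close> is
    the last letter of its block.\<close>
  have up: "{i \<in> {a..<Suc n}. \<not> k < p i \<and> k < p (Suc i)} =
      inv p ` {x \<in> block_ends p k. inv p (Suc k) < inv p x}" (is "?U = inv p ` ?E")
  proof (intro set_eqI iffI)
    fix i assume i: "i \<in> ?U"
    then have "i \<noteq> a" using a by auto
    then have "p i \<in> ?E" using i by (auto simp: block_ends_def inv_p simp flip: a_def)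
    then show "i \<in> inv p ` ?E" using inv_p by (metis imageI)
  next
    fix i assume "i \<in> inv p ` ?E"
    then obtain x where "x \<le> k" "k < p (Suc (inv p x))" "a < inv p x" "i = inv p x"
      by (auto simp: block_ends_def a_def)
    then show "i \<in> ?U" using inv_p_le[OF n p, of x] k by (auto simp: p_inv)
  qed
  \<comment> \<open>Only position \<open>a\<close> carries \<open>Suc k\<close>, so any other
    downward passage starts above \<open>Suc k\<close> and is a descent embracing it. The passage at
    \<open>a\<close> exists iff \<open>Suc k\<close> is a descent top.\<close>
  have "{i \<in> {a..<Suc n}. k < p i \<and> \<not> k < p (Suc i)} =
      {i \<in> descents n p. a < i \<and> p (Suc i) < Suc k \<and> Suc k < p i} \<union>
      (if p (Suc a) \<le> k then {a} else {})" (is "?D = ?R \<union> ?A")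
  proof (intro set_eqI iffI)
    fix i assume i: "i \<in> ?D"
    then have "i \<noteq> n" using p_Suc_n[OF n p] k by auto
    show "i \<in> ?R \<union> ?A"
    proof (cases "i = a")
      case False
      then have "p i \<noteq> Suc k" using a(2) inj_p[OF n p, of i a] by auto
      then show ?thesis using False i \<open>i \<noteq> n\<close> a(1) by (auto simp: descents_def)
    qed (use i in auto)
  qed (use a in \<open>auto simp: descents_def split: if_splits\<close>)
  moreover have "card (?R \<union> ?A) = card ?R + card ?A"
    by (rule card_Un_disjoint) (auto simp: finite_descents[OF n p])
  ultimately have "card ?D = rembr n p (Suc k) + of_bool (Suc k \<in> descent_tops n p)"
    by (simp add: rembr_def top a_def)
  \<comment> \<open>The level is exceeded at both ends, \<open>a\<close> and \<open>Suc n\<close>,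
    so the boundary terms cancel.\<close>
  moreover have "card ?D = card ?U"
    using card_crossings[of a "Suc n" "\<lambda>i. k < p i"] a k p_Suc_n[OF n p] by simp
  moreover have "card ?U = card ?E"
    unfolding up by (rule card_image) (auto simp: inj_on_def inv_p_eq_iff)
  ultimately show ?thesis by simp
qed

text \<open>On the way from a letter at most \<open>k\<close> to a later \<open>Suc k\<close> some
  block must end. Apart from the count given by \<open>card_block_ends_right\<close>, the right-hand
  side involves only letters up to \<open>k\<close>, as the induction requires.\<close>

lemma left_of_Suc_iff:
  assumes "a \<le> k"
  shows "inv p a < inv p (Suc k) \<longleftrightarrow>
    card {x \<in> block_ends p k. inv p (Suc k) < inv p x} <
    card {x \<in> block_ends p k. inv p a \<le> inv p x}" (is "_ \<longleftrightarrow> card ?R < card ?A")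
proof
  assume left: "inv p a < inv p (Suc k)"
  obtain i where i: "inv p a \<le> i" "i < inv p (Suc k)" "\<not> k < p i" "k < p (Suc i)"
    using ex_crossing[of "inv p a" "inv p (Suc k)" "\<lambda>i. k < p i"] left assms
    by (auto simp: p_inv)
  then have "p i \<in> ?A - ?R" by (auto simp: block_ends_def inv_p)
  moreover have "?R \<subseteq> ?A" using left by auto
  ultimately show "card ?R < card ?A" by (intro psubset_card_mono) auto
next
  assume "card ?R < card ?A"
  then have "\<not> ?A \<subseteq> ?R" using card_mono[of ?R ?A] by fastforce
  then show "inv p a < inv p (Suc k)"
    using inv_p_eq_iff[of a "Suc k"] assms by force
qed

text \<open>If \<open>Suc k\<close> is not a descent bottom, its left neighbour \<open>d\<close> is
  at most \<open>k\<close>, possibly the sentinel 0, and is then the rightmost such letter to its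
  left.\<close>

lemma followed_by_Suc_iff:
  assumes "a \<le> k"
  shows "p (Suc (inv p a)) = Suc k \<longleftrightarrow>
    Suc k \<notin> descent_bottoms n p \<and> inv p a < inv p (Suc k) \<and>
    (\<forall>x\<le>k. inv p x < inv p (Suc k) \<longrightarrow> \<not> inv p a < inv p x)"
proof -
  define d where "d = p (inv p (Suc k) - 1)"
  have l: "inv p (Suc k) \<in> {1..n}" using inv_p_ge[OF n p, of "Suc k"] k by auto
  have d: "Suc (inv p d) = inv p (Suc k)" using l by (auto simp: d_def inv_p)
  have bottom: "Suc k \<in> descent_bottoms n p \<longleftrightarrow> Suc k < d"
    unfolding d_def using descent_bottom_iff[OF n p, of "Suc k"] k by simp
  have "d \<noteq> Suc k" using d by auto
  show ?thesis
  proof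
    assume "p (Suc (inv p a)) = Suc k"
    then have *: "inv p (Suc k) = Suc (inv p a)" using inv_p by metis
    then have "d = a" using d inv_p_eq_iff by simp
    then show "Suc k \<notin> descent_bottoms n p \<and> inv p a < inv p (Suc k) \<and>
        (\<forall>x\<le>k. inv p x < inv p (Suc k) \<longrightarrow> \<not> inv p a < inv p x)"
      using * assms bottom by auto
  next
    assume *: "Suc k \<notin> descent_bottoms n p \<and> inv p a < inv p (Suc k) \<and>
        (\<forall>x\<le>k. inv p x < inv p (Suc k) \<longrightarrow> \<not> inv p a < inv p x)"
    then have "d \<le> k" using bottom \<open>d \<noteq> Suc k\<close> by simp
    then have "\<not> inv p a < inv p d" using * d by simp
    then have "Suc (inv p a) = inv p (Suc k)" using * d by simp
    then show "p (Suc (inv p a)) = Suc k" by (simp add: p_inv)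
  qed
qed

text \<open>Once \<open>Suc k\<close> joins the small letters, the small letter directly before it
  no longer ends a block, and \<open>Suc k\<close> ends one unless a smaller letter follows.\<close>

lemma block_ends_Suc:
  "a \<in> block_ends p (Suc k) \<longleftrightarrow>
    a \<in> block_ends p k \<and> p (Suc (inv p a)) \<noteq> Suc k \<or>
    a = Suc k \<and> Suc k \<notin> descent_tops n p"
proof (cases "a = Suc k")
  case True
  have "p (Suc (inv p (Suc k))) \<noteq> Suc k" using inv_p by (metis n_not_Suc_n)
  then show ?thesis
    using True descent_top_iff[OF n p, of "Suc k"] k by (auto simp: block_ends_def)
qed (auto simp: block_ends_def)

end

text \<open>
  By induction on \<open>k\<close>, the data determine the relative order of the letters up to \<open>k\<close> and the
  block ends: the number of blocks to the right of \<open>Suc k\<close> fixes its place among the blocks, and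
  whether it is a descent bottom or top tells whether it extends the block to its left or right.
\<close>

lemma permutes_eqI:
  assumes n: "n \<ge> 1" and p: "p permutes {1..n}" and q: "q permutes {1..n}"
    and bottoms: "descent_bottoms n p = descent_bottoms n q"
    and tops: "descent_tops n p = descent_tops n q"
    and rembr: "\<And>b. b \<in> {1..n} \<Longrightarrow> rembr n p b = rembr n q b"
  shows "p = q"
proof -
  have order: "(\<forall>a\<le>k. \<forall>b\<le>k. inv p a < inv p b \<longleftrightarrow> inv q a < inv q b) \<and>
      block_ends p k = block_ends q k" if "k \<le> n" for k
    using that
  proof (induction k)
    \<comment> \<open>Only the sentinel 0 is present, and it ends its block because the first letter
      is positive.\<close>
    case 0
    have "r (Suc 0) > 0" if "r permutes {1..n}" for r
      using range_p[OF n that, of 1] n by simp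
    then show ?case using p q by (auto simp: block_ends_def inv_p_0[OF n])
  next
    case (Suc k)
    then have k: "k < n" and less: "\<And>a b. a \<le> k \<Longrightarrow> b \<le> k \<Longrightarrow> inv p a < inv p b \<longleftrightarrow> inv q a < inv q b"
      and ends: "block_ends p k = block_ends q k" by auto
    have "card {x \<in> block_ends p k. inv p (Suc k) < inv p x} =
        card {x \<in> block_ends q k. inv q (Suc k) < inv q x}"
      using card_block_ends_right[OF n p k] card_block_ends_right[OF n q k] tops rembr k by simp
    \<comment> \<open>Block ends are at most \<open>k\<close>, so only positions of letters up to
      \<open>k\<close> are compared and the induction hypothesis applies.\<close>
    moreover have "{x \<in> block_ends p k. inv p a \<le> inv p x} = {x \<in> block_ends q k. inv q a \<le> inv q x}"
      if "a \<le> k" for a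
      using less that ends by (auto simp: block_ends_def simp flip: linorder_not_less)
    ultimately have left: "inv p a < inv p (Suc k) \<longleftrightarrow> inv q a < inv q (Suc k)" if "a \<le> k" for a
      using left_of_Suc_iff[OF n p k that] left_of_Suc_iff[OF n q k that] that by simp
    have right: "inv p (Suc k) < inv p a \<longleftrightarrow> inv q (Suc k) < inv q a" if "a \<le> k" for a
      using left[OF that] that inv_eq_iff[OF n p, of a "Suc k"] inv_eq_iff[OF n q, of a "Suc k"]
      by auto
    have "p (Suc (inv p a)) = Suc k \<longleftrightarrow> q (Suc (inv q a)) = Suc k" if "a \<le> k" for a
      using followed_by_Suc_iff[OF n p k that] followed_by_Suc_iff[OF n q k that]
        bottoms left less that by simp
    then have "block_ends p (Suc k) = block_ends q (Suc k)"
      using ends tops block_ends_Suc[OF n p k] block_ends_Suc[OF n q k]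
      by (auto simp: block_ends_def)
    then show ?case using less left right by (auto simp: le_Suc_eq)
  qed
  \<comment> \<open>The position of a letter is the number of letters to its left; counting the
    sentinel 0 matches the numbering from 1. Relative order thus determines positions.\<close>
  have card_left: "inv r a = card {b \<in> {..n}. inv r b < inv r a}"
    if r: "r permutes {1..n}" and a: "a \<le> n" for r a
  proof -
    have "{b \<in> {..n}. inv r b < inv r a} = r ` {..<inv r a}"
    proof (intro set_eqI iffI)
      fix b assume "b \<in> r ` {..<inv r a}"
      then obtain i where i: "i < inv r a" "b = r i" by auto
      then have "i \<le> n" using inv_p_le[OF n r a] by simp
      then have "r i \<le> n" using range_p[OF n r, of i] p_0[OF n r] by (cases i) auto
      then show "b \<in> {b \<in> {..n}. inv r b < inv r a}" using i inv_apply[OF n r] by simp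
    next
      fix b assume "b \<in> {b \<in> {..n}. inv r b < inv r a}"
      then show "b \<in> r ` {..<inv r a}" using apply_inv[OF n r, of b] by force
    qed
    then show ?thesis using inj_p[OF n r] by (simp add: card_image inj_on_def)
  qed
  have "inv p a = inv q a" for a
  proof (cases "a \<le> n")
    case True
    then have "{b \<in> {..n}. inv p b < inv p a} = {b \<in> {..n}. inv q b < inv q a}"
      using order[of n] by auto
    then show ?thesis using card_left[OF p True] card_left[OF q True] by simp
  next
    case False
    then show ?thesis
      using permutes_not_in[OF permutes_inv[OF p]] permutes_not_in[OF permutes_inv[OF q]] by simp
  qed
  then have "inv p = inv q" by (rule ext)
  then show "p = q" using permutes_inv_inv[OF p] permutes_inv_inv[OF q] by metis
qed

section \<open>Bijectivity of the map\<close>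

text \<open>The weak excedance bottoms and tops of the image give back the descent sets, and its
  crossing counts give back each \<open>rembr\<close>, so \<open>permutes_eqI\<close>
  applies.\<close>

lemma inj_on_Psi:
  assumes "n \<ge> 1"
  shows "inj_on (Psi n) {p. p permutes {1..n}}"
proof (rule inj_onI)
  fix p q
  assume p: "p \<in> {p. p permutes {1..n}}" and q: "q \<in> {p. p permutes {1..n}}"
    and eq: "Psi n p = Psi n q"
  have "DB' n p = DB' n q" "DT' n p = DT' n q"
    using WB_Psi[of n p] WB_Psi[of n q] WT_Psi[of n p] WT_Psi[of n q] assms p q eq by simp_all
  then show "p = q"
    using assms p q eq
    by (intro permutes_eqI[of n p q])
      (simp_all add: descent_bottoms_eq descent_tops_eq rembr_eq_card_C)
qed

theorem theorem21:
  fixes n :: nat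
  assumes "n \<ge> 1"
  shows "(\<forall>p. p permutes {1..n} \<longrightarrow>
            Psi_well_defined n p \<and> Psi n p permutes {1..n} \<and>
            WB n (Psi n p) = DB' n p \<and>
            WT n (Psi n p) = DT' n p \<and>
            C_EE n (Psi n p) + C_NN n (Psi n p) = rembr_total n p) \<and>
         bij_betw (Psi n) {p. p permutes {1..n}} {p. p permutes {1..n}}"
proof -
  have "Psi n ` {p. p permutes {1..n}} \<subseteq> {p. p permutes {1..n}}"
    using Psi_permutes[OF assms] by auto
  \<comment> \<open>An injective self-map of a finite set is onto.\<close>
  then have "Psi n ` {p. p permutes {1..n}} = {p. p permutes {1..n}}"
    by (rule endo_inj_surj[rotated]) (use inj_on_Psi[OF assms] in \<open>auto simp: finite_permutations\<close>)
  then show ?thesis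
    using well_defined[OF assms] Psi_permutes[OF assms] WB_Psi[OF assms] WT_Psi[OF assms]
      C_total[OF assms] inj_on_Psi[OF assms]
    by (simp add: bij_betw_def)
qed

end
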